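(* Let $k\ge 1$ be an integer, $T>0$, and for $1\le i\le k$ let $\beta_i:[0,T]\to[\beta_{\min},\beta_{\max}]$ and $\nu_i:[0,T]\to[\nu_{\min},\nu_{\max}]$ be continuous functions, where $0<\beta_{\min}<\beta_{\max}<\infty$ and $0<\nu_{\min}<\nu_{\max}<\infty$ are constants independent of $i$. Let $(\Omega,\mathscr{F})$ be a measurable space carrying a $k$-dimensional vector of counting processes $N_t=(N_t(1),\dots,N_t(k))$, $t\in[0,T]$, and let $\mathscr{F}^N_t=\sigma(N_s:0\le s\le t)$. Let $\mathbb{P}_0$ and $\mathbb{P}_1$ be probability measures on $(\Omega,\mathscr{F})$ such that, under $\mathbb{P}_0$, the $N_t(i)$, $1\le i\le k$, are independent $\mathscr{F}^N_t$-Poisson processes over $[0,T]$ with intensities $\beta_i(t)$, respectively, and, under $\mathbb{P}_1$, the $N_t(i)$, $1\le i\le k$, are independent $\mathscr{F}^N_t$-Poisson processes over $[0,T]$ with intensities $\beta_i(t)+\nu_i(t)$, respectively. Let $(\tau_n(i):n\ge1)$ be the jump times of $N_t(i)$ and define \[ L_T=\prod_{i=1}^k\left[\exp\left(-\int_0^T\nu_i(s)\,ds\right)\prod_{n=1}^{N_T(i)}\left(1+\frac{\nu_i(\tau_n(i))}{\beta_i(\tau_n(i))}\right)\right], \] \[ B=\sum_{i=1}^k\int_0^T\beta_i(s)\,ds,\quad J=\sum_{i=1}^k\int_0^T\nu_i(s)\,ds,\quad C=1+\frac{\nu_{\min}}{\beta_{\max}},\quad D=1+\frac{\nu_{\max}}{\beta_{\min}}.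 \] Then for every $\gamma>0$, \[ \mathbb{P}_1(L_T\ge\gamma)\ \ge\ \overline{P}\left(J+B,\left\lceil\frac{\log\gamma+J}{\log C}\right\rceil\right) \] and \[ \mathbb{P}_0(L_T\ge\gamma)\ \le\ \overline{P}\left(B,\left\lceil\frac{\log\gamma+J}{\log D}\right\rceil\right). \]
   Context: $\mathbb{Z}^+=\{0,1,2,\dots\}$. A counting process is a $\mathbb{Z}^+$-valued process with value $0$ at time $0$ whose sample paths are non-decreasing, piecewise constant, right-continuous, and increase in steps of size one; its jump times $\tau_1<\tau_2<\cdots$ are the successive times at which it increases. Empty products equal $1$. Given a probability measure $\mathbb{P}$ and a filtration $(\mathscr{F}_t)$, an $(\mathscr{F}_t)$-adapted counting process $X_t$ is a $(\mathbb{P},\mathscr{F}_t)$-Poisson process over $[0,T]$ with (deterministic) intensity $\lambda(t)$ (nonnegative, measurable, integrable on $[0,T]$) if for all $0\le s\le t\le T$: (1) $X_t-X_s$ is independent of $\mathscr{F}_s$ under $\mathbb{P}$, and (2) under $\mathbb{P}$, $X_t-X_s$ is a Poisson random variable with parameter $\int_s^t\lambda(u)\,du$. For $\lambda>0$ and $j\in\mathbb{Z}^+$ let $p(\lambda,j)=e^{-\lambda}\lambda^j/j!$. The right Poisson tail is $\overline{P}(\lambda,n)=\sum_{j=n}^\infty p(\lambda,j)$; for integers $n\le 0$ this is understood as $\overline{P}(\lambda,n)=1$ (sum over $j\in\mathbb{Z}^+$ with $j\ge n$). $\lceil x\rceil$ is the smallest integer greater than or equal to $x$, and $\log$ is the natural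 logarithm. *)

theory Defs
  imports "HOL-Probability.Probability"
begin

definition piecewise_constant_on :: "real \<Rightarrow> (real \<Rightarrow> nat) \<Rightarrow> bool" where
  "piecewise_constant_on T f \<longleftrightarrow>
     (\<exists>S. finite S \<and> (\<forall>I. is_interval I \<and> I \<subseteq> {0..T} - S \<longrightarrow> f constant_on I))"

definition counting_path :: "real \<Rightarrow> (real \<Rightarrow> nat) \<Rightarrow> bool" where
  "counting_path T f \<longleftrightarrow>
     f 0 = 0 \<and>
     mono_on {0..T} f \<and>
     piecewise_constant_on T f \<and>
     (\<forall>t\<in>{0..<T}. continuous (at_right t) f) \<and>
     (\<forall>t\<in>{0<..T}. \<exists>l. (f \<longlongrightarrow> l) (at_left t) \<and> f t \<in> {l, Suc l})"

definition counting_process :: "'a measure \<Rightarrow> real \<Rightarrow> (real \<Rightarrow> 'a \<Rightarrow> nat) \<Rightarrow> bool" where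
  "counting_process M T X \<longleftrightarrow>
     (\<forall>t\<in>{0..T}. X t \<in> M \<rightarrow>\<^sub>M count_space UNIV) \<and>
     (\<forall>\<omega>\<in>space M. counting_path T (\<lambda>t. X t \<omega>))"

definition increase_times :: "real \<Rightarrow> (real \<Rightarrow> nat) \<Rightarrow> real set" where
  "increase_times T f = {t \<in> {0<..T}. \<forall>s\<in>{0..<t}. f s < f t}"

text \<open>
  The jump times are numbered from 1. Only the values for \<open>1 \<le> n \<le> f T\<close> are meaningful: a counting
  path has exactly \<open>f T\<close> jumps in \<open>{0<..T}\<close>.
\<close>

definition jump_time :: "real \<Rightarrow> (real \<Rightarrow> nat) \<Rightarrow> nat \<Rightarrow> real" where
  "jump_time T f n = sorted_list_of_set (increase_times T f) ! (n - 1)"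

text \<open>The formula is used also for \<open>\<rho> = 0\<close>, where it gives the point mass at 0 (as \<open>0 ^ 0 = 1\<close>).\<close>

definition poisson_mass :: "real \<Rightarrow> nat \<Rightarrow> real" where
  "poisson_mass \<rho> j = exp (- \<rho>) * \<rho> ^ j / fact j"

lemma poisson_mass_eq_pmf: "\<rho> > 0 \<Longrightarrow> poisson_mass \<rho> j = pmf (poisson_pmf \<rho>) j"
  by (simp add: poisson_mass_def)

definition poisson_tail :: "real \<Rightarrow> int \<Rightarrow> real" where
  "poisson_tail \<rho> n = (\<Sum>\<^sub>\<infinity>j\<in>{j. n \<le> int j}. poisson_mass \<rho> j)"

lemma has_sum_poisson_mass:
  assumes "\<rho> > 0"
  shows "(poisson_mass \<rho> has_sum 1) UNIV"
proof -
  have "(\<lambda>j. exp (- \<rho>) * (\<rho> ^ j /\<^sub>R fact j)) sums (exp (- \<rho>) * exp \<rho>)"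
    by (intro sums_mult exp_converges)
  then have "poisson_mass \<rho> sums 1"
    by (simp add: poisson_mass_def [abs_def] exp_minus field_simps)
  moreover have "poisson_mass \<rho> j \<ge> 0" for j
    using assms by (simp add: poisson_mass_def)
  ultimately show ?thesis
    by (rule sums_nonneg_imp_has_sum)
qed

lemma poisson_tail_nonpos:
  assumes "\<rho> > 0" and "n \<le> 0"
  shows "poisson_tail \<rho> n = 1"
proof -
  have "{j. n \<le> int j} = UNIV"
    using assms(2) by auto
  then show ?thesis
    using has_sum_poisson_mass [OF assms(1)] by (simp add: poisson_tail_def infsumI)
qed

text \<open>
  The filtration generated by the components \<open>N 1, \<dots>, N k\<close>; this is the filtration generated by
  the vector-valued process, as the \<open>\<sigma>\<close>-algebra generated by a vector is generated by its components.
\<close>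

definition natural_filtration ::
  "'a set \<Rightarrow> nat \<Rightarrow> (nat \<Rightarrow> real \<Rightarrow> 'a \<Rightarrow> nat) \<Rightarrow> real \<Rightarrow> 'a measure" where
  "natural_filtration \<Omega> k N t =
     sigma \<Omega> {N i s -` A \<inter> \<Omega> | i s A. i \<in> {1..k} \<and> s \<in> {0..t}}"

lemma filtration_natural_filtration: "filtration \<Omega> (natural_filtration \<Omega> k N)"
proof
  show "space (natural_filtration \<Omega> k N t) = \<Omega>" for t
    by (auto simp: natural_filtration_def intro!: space_measure_of)
  show "sets (natural_filtration \<Omega> k N s) \<subseteq> sets (natural_filtration \<Omega> k N t)" if "s \<le> t" for s t
  proof -
    have 1: "{N i u -` A \<inter> \<Omega> | i u A. i \<in> {1..k} \<and> u \<in> {0..r}} \<subseteq> Pow \<Omega>" for r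
      by auto
    show ?thesis
      unfolding natural_filtration_def sets_measure_of [OF 1] using that
      by (intro sigma_sets_mono') fastforce
  qed
qed

text \<open>
  Sample paths are non-decreasing, so the truncated subtraction on \<^typ>\<open>nat\<close> is the true increment.
\<close>

definition poisson_process ::
  "'a measure \<Rightarrow> (real \<Rightarrow> 'a measure) \<Rightarrow> real \<Rightarrow> (real \<Rightarrow> real) \<Rightarrow> (real \<Rightarrow> 'a \<Rightarrow> nat) \<Rightarrow> bool" where
  "poisson_process P F T \<rho> X \<longleftrightarrow>
     prob_space P \<and> filtration (space P) F \<and>
     counting_process P T X \<and>
     (\<forall>t\<in>{0..T}. X t \<in> F t \<rightarrow>\<^sub>M count_space UNIV) \<and>
     (\<forall>t\<in>{0..T}. 0 \<le> \<rho> t) \<and> set_integrable lborel {0..T} \<rho> \<and>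
     (\<forall>s t. 0 \<le> s \<and> s \<le> t \<and> t \<le> T \<longrightarrow>
        prob_space.indep_set P
          {(\<lambda>\<omega>. X t \<omega> - X s \<omega>) -` A \<inter> space P | A. True} (sets (F s)) \<and>
        (\<forall>j. measure P {\<omega> \<in> space P. X t \<omega> - X s \<omega> = j}
               = poisson_mass (LINT u:{s..t}|lborel. \<rho> u) j))"

text \<open>Processes are independent if their paths are, as random elements of the product space.\<close>

definition independent_processes ::
  "'a measure \<Rightarrow> nat \<Rightarrow> real \<Rightarrow> (nat \<Rightarrow> real \<Rightarrow> 'a \<Rightarrow> nat) \<Rightarrow> bool" where
  "independent_processes P k T N \<longleftrightarrow>
     prob_space.indep_vars P (\<lambda>i. \<Pi>\<^sub>M t\<in>{0..T}. count_space UNIV)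
       (\<lambda>i \<omega>. \<lambda>t\<in>{0..T}. N i t \<omega>) {1..k}"

end

theory Submission
  imports Defs
begin

text \<open>
  Let \<open>S\<close> be the total number of jumps up to time \<open>T\<close>. The likelihood ratio \<open>L\<close> is \<open>exp (- J)\<close>
  times a product of \<open>S\<close> factors \<open>1 + \<nu>\<^sub>i / \<beta>\<^sub>i\<close>, each of which lies between \<open>C\<close> and \<open>D\<close>. Hence
  \<open>exp (- J) * C ^ S \<le> L \<le> exp (- J) * D ^ S\<close>, and after taking logarithms the event \<open>L \<ge> \<gamma>\<close>
  contains \<open>S \<ge> (ln \<gamma> + J) / ln C\<close> and is contained in \<open>S \<ge> (ln \<gamma> + J) / ln D\<close>. As a sum of
  independent Poisson variables, \<open>S\<close> is Poisson with parameter \<open>J + B\<close> under \<open>P1\<close> and \<open>B\<close> under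
  \<open>P0\<close> (\<open>total_count_tail\<close>), so these two events have the stated tails as probabilities.

  The factors are evaluated at jump times, and to bound them it must be known that the \<open>n\<close>-th jump
  time lies in the interval for every \<open>n \<le> f T\<close>, that is, that a counting path \<open>f\<close> really has \<open>f T\<close>
  jumps. This follows because \<open>f\<close> itself is a bijection from its times of increase onto
  \<open>{1..f T}\<close> (\<open>bij_betw_increase_times\<close>). The same fact gives \<open>\<tau>\<^sub>n \<le> t \<longleftrightarrow> n \<le> f t\<close>, which makes jump
  times random variables and \<open>L\<close> measurable (\<open>jump_product_measurable\<close>).
\<close>

section \<open>Jump times of a counting path\<close>

text \<open>
  The witness is the first time at which the path reaches \<open>m\<close>. Right-continuity shows that the infimum
  is attained; the left limit there is below \<open>m\<close>, so a jump by at most one cannot overshoot \<open>m\<close>.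
\<close>

lemma increase_time_of_value:
  assumes f: "counting_path T f" and t: "t \<in> {0..T}" and m: "1 \<le> m" "m \<le> f t"
  shows "\<exists>s\<in>increase_times T f. s \<le> t \<and> f s = m"
proof -
  have f0: "f 0 = 0" and mono: "mono_on {0..T} f"
    and right: "\<And>s. s \<in> {0..<T} \<Longrightarrow> continuous (at_right s) f"
    and left: "\<And>s. s \<in> {0<..T} \<Longrightarrow> \<exists>l. (f \<longlongrightarrow> l) (at_left s) \<and> f s \<in> {l, Suc l}"
    using f by (auto simp: counting_path_def)
  define A where "A = {s \<in> {0..T}. m \<le> f s}"
  define \<sigma> where "\<sigma> = Inf A"
  have tA: "t \<in> A" using t m by (simp add: A_def)
  have bdd: "bdd_below A" by (rule bdd_belowI[of _ 0]) (simp add: A_def)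
  have \<sigma>t: "\<sigma> \<le> t" using tA bdd by (simp add: \<sigma>_def cInf_lower)
  have \<sigma>0: "0 \<le> \<sigma>" unfolding \<sigma>_def using tA by (intro cInf_greatest) (auto simp: A_def)
  have before: "f s < m" if "s \<in> {0..<\<sigma>}" for s
  proof (rule ccontr)
    assume "\<not> f s < m"
    then have "s \<in> A" using that \<sigma>t t by (simp add: A_def)
    then have "\<sigma> \<le> s" using bdd by (simp add: \<sigma>_def cInf_lower)
    then show False using that by simp
  qed
  have m_le: "m \<le> f \<sigma>"
  proof (cases "\<sigma> < T")
    case True
    with right[of \<sigma>] \<sigma>0 have "(f \<longlongrightarrow> f \<sigma>) (at_right \<sigma>)"
      by (simp add: continuous_within)
    then have "eventually (\<lambda>s. f s = f \<sigma>) (at_right \<sigma>)"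
      by (simp add: tendsto_discrete)
    then obtain b where b: "b > \<sigma>" "\<And>s. s > \<sigma> \<Longrightarrow> s < b \<Longrightarrow> f s = f \<sigma>"
      unfolding eventually_at_right_field by blast
    obtain a where a: "a \<in> A" "a < b"
      using cInf_lessD[of A b] tA b(1) by (auto simp: \<sigma>_def)
    have "\<sigma> \<le> a" using a bdd by (simp add: \<sigma>_def cInf_lower)
    then have "f a = f \<sigma>" using b(2)[of a] a(2) by (cases "a = \<sigma>") auto
    then show ?thesis using a(1) by (simp add: A_def)
  next
    case False
    then have "\<sigma> = t" using \<sigma>t t by simp
    then show ?thesis using m by simp
  qed
  have \<sigma>pos: "0 < \<sigma>" using \<sigma>0 m_le m(1) f0 by (cases "\<sigma> = 0") auto
  obtain l where l: "(f \<longlongrightarrow> l) (at_left \<sigma>)" "f \<sigma> \<in> {l, Suc l}"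
    using left[of \<sigma>] \<sigma>pos \<sigma>t t by auto
  have "eventually (\<lambda>s. f s = l) (at_left \<sigma>)"
    using l(1) by (simp add: tendsto_discrete)
  then obtain b where b: "b < \<sigma>" "\<And>s. s > b \<Longrightarrow> s < \<sigma> \<Longrightarrow> f s = l"
    unfolding eventually_at_left_field by blast
  obtain s where s: "max 0 b < s" "s < \<sigma>"
    using dense[of "max 0 b" \<sigma>] b(1) \<sigma>pos by auto
  have "l < m" using b(2)[of s] before[of s] s by auto
  then have "f \<sigma> = m" using l(2) m_le by auto
  moreover have "\<sigma> \<in> increase_times T f"
    using \<sigma>pos \<sigma>t t before m_le by (fastforce simp: increase_times_def)
  ultimately show ?thesis using \<sigma>t by blast
qed

lemma strict_mono_on_increase_times: "strict_mono_on (increase_times T f) f"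
  by (rule strict_mono_onI) (auto simp: increase_times_def)

lemma bij_betw_increase_times:
  assumes f: "counting_path T f" and T: "0 \<le> T"
  shows "bij_betw f (increase_times T f) {1..f T}"
proof (intro bij_betw_imageI subset_antisym subsetI)
  show "inj_on f (increase_times T f)"
    by (intro strict_mono_on_imp_inj_on strict_mono_on_increase_times)
next
  fix m assume "m \<in> f ` increase_times T f"
  then obtain s where s: "s \<in> increase_times T f" "m = f s" by auto
  then have "f 0 < f s" "s \<in> {0..T}" by (auto simp: increase_times_def)
  moreover have "f s \<le> f T"
    using f calculation(2) by (auto simp: counting_path_def intro: mono_onD)
  ultimately show "m \<in> {1..f T}" using s by simp
next
  fix m assume "m \<in> {1..f T}"
  then show "m \<in> f ` increase_times T f"
    using increase_time_of_value[OF f, of T m] T by force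
qed

text \<open>
  Along the sorted list of times of increase the path takes strictly increasing values with range
  \<open>{1..f T}\<close>. Only one sorted list has this set of elements, so the \<open>n\<close>-th value is \<open>n\<close>.
\<close>

lemma jump_time_properties:
  assumes f: "counting_path T f" and T: "0 \<le> T" and n: "n \<in> {1..f T}"
  shows jump_time_in_increase_times: "jump_time T f n \<in> increase_times T f"
    and value_at_jump_time: "f (jump_time T f n) = n"
proof -
  define xs where "xs = sorted_list_of_set (increase_times T f)"
  have bij: "bij_betw f (increase_times T f) {1..f T}"
    by (rule bij_betw_increase_times[OF f T])
  then have fin: "finite (increase_times T f)"
    using bij_betw_finite by blast
  have set: "set xs = increase_times T f" and sorted: "sorted_wrt (<) xs"
    using fin by (simp_all add: xs_def)
  have "sorted_wrt (\<lambda>x y. f x < f y) xs"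
    using sorted strict_mono_onD[OF strict_mono_on_increase_times[of T f]]
    by (rule_tac sorted_wrt_mono_rel[of xs "(<)"]) (auto simp: set)
  then have "sorted_wrt (<) (map f xs)"
    by (simp add: sorted_wrt_map)
  moreover have "set (map f xs) = set [1..<Suc (f T)]"
    using bij by (auto simp: set bij_betw_def)
  ultimately have map: "map f xs = [1..<Suc (f T)]"
    by (intro strict_sorted_equal) (simp_all del: upt_Suc)
  have len: "n - 1 < length xs"
    using n arg_cong[OF map, of length] by auto
  show "jump_time T f n \<in> increase_times T f"
    using nth_mem[OF len] set by (simp add: jump_time_def xs_def)
  have "f (xs ! (n - 1)) = map f xs ! (n - 1)" using len by simp
  also have "\<dots> = n" using n unfolding map by (simp del: upt_Suc)
  finally show "f (jump_time T f n) = n"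
    by (simp add: jump_time_def xs_def)
qed

lemma jump_time_le_iff:
  assumes f: "counting_path T f" and n: "n \<in> {1..f T}" and t: "t \<in> {0..T}"
  shows "jump_time T f n \<le> t \<longleftrightarrow> n \<le> f t"
proof -
  have T: "0 \<le> T" using t by simp
  note inc = jump_time_in_increase_times[OF f T n]
  note val = value_at_jump_time[OF f T n]
  show ?thesis
  proof
    assume "jump_time T f n \<le> t"
    moreover have "mono_on {0..T} f" using f by (simp add: counting_path_def)
    ultimately have "f (jump_time T f n) \<le> f t"
      using inc t by (intro mono_onD[of "{0..T}" f]) (auto simp: increase_times_def)
    then show "n \<le> f t" by (simp add: val)
  next
    assume "n \<le> f t"
    then show "jump_time T f n \<le> t"
      using inc t val by (force simp: increase_times_def not_le[symmetric])
  qed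
qed

lemma jump_time_in_interval:
  assumes "counting_path T f" "0 \<le> T" "n \<in> {1..f T}"
  shows "jump_time T f n \<in> {0..T}"
  using jump_time_in_increase_times[OF assms] by (simp add: increase_times_def)

section \<open>Products over the jumps of a counting process\<close>

text \<open>
  On the event of fewer than \<open>n\<close> jumps, \<^const>\<open>jump_time\<close> indexes past the end of a list; the value
  \<open>T\<close> replaces it there and keeps the variable inside the interval.
\<close>

lemma jump_time_measurable:
  assumes X: "counting_process M T X" and T: "0 \<le> T" and n: "1 \<le> n"
  shows "(\<lambda>\<omega>. if n \<le> X T \<omega> then jump_time T (\<lambda>t. X t \<omega>) n else T) \<in> borel_measurable M"
    (is "?\<tau> \<in> _")
proof (rule borel_measurableI_le)
  fix a :: real
  have path: "counting_path T (\<lambda>t. X t \<omega>)" if "\<omega> \<in> space M" for \<omega>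
    using X that by (simp add: counting_process_def)
  have range: "?\<tau> \<omega> \<in> {0..T}" if "\<omega> \<in> space M" for \<omega>
    using jump_time_in_interval[OF path[OF that] T, of n] n T by auto
  consider "a < 0" | "a \<ge> T" | "0 \<le> a" "a < T" by linarith
  then show "{\<omega> \<in> space M. ?\<tau> \<omega> \<le> a} \<in> sets M"
  proof cases
    case 1
    then have "{\<omega> \<in> space M. ?\<tau> \<omega> \<le> a} = {}" using range by fastforce
    then show ?thesis by (simp only: sets.empty_sets)
  next
    case 2
    then have "{\<omega> \<in> space M. ?\<tau> \<omega> \<le> a} = space M" using range by fastforce
    then show ?thesis by (simp only: sets.top)
  next
    case 3
    have "?\<tau> \<omega> \<le> a \<longleftrightarrow> n \<le> X a \<omega>" if "\<omega> \<in> space M" for \<omega>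
    proof -
      have "X a \<omega> \<le> X T \<omega>"
        using path[OF that] 3 by (auto simp: counting_path_def intro: mono_onD)
      then show ?thesis
        using jump_time_le_iff[OF path[OF that], of n a] n 3 by auto
    qed
    then have "{\<omega> \<in> space M. ?\<tau> \<omega> \<le> a} = {\<omega> \<in> space M. n \<le> X a \<omega>}"
      by (intro Collect_cong conj_cong refl)
    also have "\<dots> = X a -` {n..} \<inter> space M" by auto
    finally have "{\<omega> \<in> space M. ?\<tau> \<omega> \<le> a} = X a -` {n..} \<inter> space M" .
    moreover have "X a \<in> M \<rightarrow>\<^sub>M count_space UNIV"
      using X 3 by (simp add: counting_process_def)
    ultimately show ?thesis by (simp only: measurable_sets sets_count_space Pow_UNIV UNIV_I)
  qed
qed

lemma jump_product_measurable:
  fixes h :: "real \<Rightarrow> real"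
  assumes X: "counting_process M T X" and T: "0 \<le> T" and h: "continuous_on {0..T} h"
  shows "(\<lambda>\<omega>. \<Prod>n=1..X T \<omega>. h (jump_time T (\<lambda>t. X t \<omega>) n)) \<in> borel_measurable M"
proof -
  \<comment> \<open>Continuity is available on the interval only, so \<open>h\<close> is extended by 0 to a Borel function.\<close>
  define h' where "h' x = indicator {0..T} x * h x" for x
  define \<tau> where "\<tau> n \<omega> = (if n \<le> X T \<omega> then jump_time T (\<lambda>t. X t \<omega>) n else T)" for n \<omega>
  have [measurable]: "h' \<in> borel_measurable borel"
    using borel_measurable_continuous_on_indicator[OF _ h] by (simp add: h'_def[abs_def])
  have [measurable]: "X T \<in> M \<rightarrow>\<^sub>M count_space UNIV"
    using X T by (simp add: counting_process_def)
  have \<tau>: "\<tau> n \<in> borel_measurable M" if "n \<in> {1..m}" for n m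
    unfolding \<tau>_def[abs_def] using that by (intro jump_time_measurable[OF X T]) simp
  have factor: "(\<lambda>\<omega>. if n \<le> X T \<omega> then h' (\<tau> n \<omega>) else 1) \<in> borel_measurable M"
    if "n \<in> {1..m}" for n m
  proof -
    note [measurable] = \<tau>[OF that]
    show ?thesis by measurable
  qed
  \<comment> \<open>The random number of factors takes countably many values \<open>m\<close>; for each, the product is measurable.\<close>
  have "(\<lambda>\<omega>. (\<lambda>m \<omega>. \<Prod>n=1..m. if n \<le> X T \<omega> then h' (\<tau> n \<omega>) else 1) (X T \<omega>) \<omega>)
      \<in> borel_measurable M"
    by (rule measurable_compose_countable) (auto intro!: borel_measurable_prod factor)
  moreover have "(\<Prod>n=1..X T \<omega>. if n \<le> X T \<omega> then h' (\<tau> n \<omega>) else 1)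
      = (\<Prod>n=1..X T \<omega>. h (jump_time T (\<lambda>t. X t \<omega>) n))" if "\<omega> \<in> space M" for \<omega>
    using jump_time_in_interval[of T "\<lambda>t. X t \<omega>"] X T that
    by (intro prod.cong) (auto simp: h'_def \<tau>_def counting_process_def)
  ultimately show ?thesis
    by (simp cong: measurable_cong)
qed

lemma jump_product_bounds:
  fixes h :: "real \<Rightarrow> real"
  assumes f: "counting_path T f" and T: "0 \<le> T" and c: "0 \<le> c"
    and h: "\<And>t. t \<in> {0..T} \<Longrightarrow> h t \<in> {c..d}"
  shows "(\<Prod>n=1..f T. h (jump_time T f n)) \<in> {c ^ f T..d ^ f T}"
proof -
  have *: "h (jump_time T f n) \<in> {c..d}" if "n \<in> {1..f T}" for n
    using that by (intro h jump_time_in_interval f T)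
  have "(\<Prod>n=1..f T. c) \<le> (\<Prod>n=1..f T. h (jump_time T f n))"
    using * c by (intro prod_mono) auto
  moreover have "(\<Prod>n=1..f T. h (jump_time T f n)) \<le> (\<Prod>n=1..f T. d)"
    using * c by (intro prod_mono) (force intro: order_trans)
  ultimately show ?thesis by simp
qed

section \<open>Sums of independent Poisson variables\<close>

text \<open>This is the binomial theorem for \<open>(a + b) ^ n\<close>, divided by \<open>fact n\<close>.\<close>

lemma poisson_mass_convolution:
  "(\<Sum>j\<le>n. poisson_mass a j * poisson_mass b (n - j)) = poisson_mass (a + b) n"
proof -
  have "poisson_mass a j * poisson_mass b (n - j)
      = exp (- (a + b)) / fact n * (of_nat (n choose j) * a ^ j * b ^ (n - j))"
    if "j \<le> n" for j
    using that by (simp add: poisson_mass_def binomial_fact mult_exp_exp field_simps)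
  then have "(\<Sum>j\<le>n. poisson_mass a j * poisson_mass b (n - j))
      = exp (- (a + b)) / fact n * (\<Sum>j\<le>n. of_nat (n choose j) * a ^ j * b ^ (n - j))"
    by (simp add: sum_distrib_left)
  then show ?thesis
    by (simp add: binomial_ring[symmetric] poisson_mass_def)
qed

text \<open>
  The law is expressed by \<^const>\<open>poisson_mass\<close>, so that parameters 0, and with them the empty sum,
  are covered. Independence is stated for the real-valued versions, as sums of independent variables
  are treated in that form.
\<close>

lemma (in prob_space) poisson_sum:
  fixes X :: "'i \<Rightarrow> 'a \<Rightarrow> nat"
  assumes "finite I"
    and "indep_vars (\<lambda>_. borel) (\<lambda>i \<omega>. real (X i \<omega>)) I"
    and "\<And>i j. i \<in> I \<Longrightarrow> prob {\<omega> \<in> space M. X i \<omega> = j} = poisson_mass (r i) j"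
  shows "prob {\<omega> \<in> space M. (\<Sum>i\<in>I. X i \<omega>) = n} = poisson_mass (\<Sum>i\<in>I. r i) n"
  using assms
proof (induction I arbitrary: n rule: finite_induct)
  case empty
  show ?case
    by (cases n) (simp_all add: poisson_mass_def prob_space)
next
  case (insert i I)
  let ?S = "\<lambda>\<omega>. \<Sum>i\<in>I. X i \<omega>"
  let ?A = "\<lambda>j. {\<omega> \<in> space M. X i \<omega> = j \<and> ?S \<omega> = n - j}"
  have indep: "indep_var borel (\<lambda>\<omega>. real (X i \<omega>)) borel (\<lambda>\<omega>. \<Sum>i\<in>I. real (X i \<omega>))"
    using insert by (intro indep_vars_sum) auto
  have IH: "prob {\<omega> \<in> space M. ?S \<omega> = m} = poisson_mass (\<Sum>i\<in>I. r i) m" for m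
    using insert.prems by (intro insert.IH) (auto intro: indep_vars_subset)
  have [measurable]: "(\<lambda>\<omega>. real (X i \<omega>)) \<in> borel_measurable M"
      "(\<lambda>\<omega>. \<Sum>i\<in>I. real (X i \<omega>)) \<in> borel_measurable M"
    using indep indep_var_rv1 indep_var_rv2 by blast+
  have A_eq: "?A j = (\<lambda>\<omega>. real (X i \<omega>)) -` {real j} \<inter> space M
      \<inter> ((\<lambda>\<omega>. \<Sum>i\<in>I. real (X i \<omega>)) -` {real (n - j)} \<inter> space M)" for j
    by (auto simp flip: of_nat_sum)
  have A_sets: "?A j \<in> events" for j
    unfolding A_eq by measurable
  have "prob (?A j) = poisson_mass (r i) j * poisson_mass (\<Sum>i\<in>I. r i) (n - j)" for j
  proof -
    have "(\<lambda>\<omega>. real (X i \<omega>)) -` {real j} \<inter> space M = {\<omega> \<in> space M. X i \<omega> = j}"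
      "(\<lambda>\<omega>. \<Sum>i\<in>I. real (X i \<omega>)) -` {real (n - j)} \<inter> space M = {\<omega> \<in> space M. ?S \<omega> = n - j}"
      by (auto simp flip: of_nat_sum)
    moreover have "?A j = (\<lambda>\<omega>. (real (X i \<omega>), \<Sum>i\<in>I. real (X i \<omega>))) -`
        ({real j} \<times> {real (n - j)}) \<inter> space M"
      unfolding A_eq by auto
    moreover note indep_varD[OF indep, of "{real j}" "{real (n - j)}"]
    ultimately show ?thesis
      using insert.prems(2)[of i j] IH[of "n - j"] by simp
  qed
  moreover have "{\<omega> \<in> space M. (\<Sum>i\<in>insert i I. X i \<omega>) = n} = (\<Union>j\<le>n. ?A j)"
    using insert.hyps by auto
  moreover have "prob (\<Union>j\<le>n. ?A j) = (\<Sum>j\<le>n. prob (?A j))"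
    using A_sets by (intro finite_measure_finite_Union) (auto simp: disjoint_family_on_def)
  ultimately show ?case
    using insert.hyps by (simp add: poisson_mass_convolution)
qed

lemma (in prob_space) poisson_tail_eq_prob:
  assumes S[measurable]: "S \<in> M \<rightarrow>\<^sub>M count_space UNIV"
    and mass: "\<And>j. prob {\<omega> \<in> space M. S \<omega> = j} = poisson_mass r j"
  shows "prob {\<omega> \<in> space M. n \<le> int (S \<omega>)} = poisson_tail r n"
proof -
  let ?A = "\<lambda>j. {\<omega> \<in> space M. S \<omega> = j \<and> n \<le> int j}"
  have "(\<lambda>j. prob (?A j)) sums prob (\<Union>j. ?A j)"
    by (intro finite_measure_UNION) (auto simp: disjoint_family_on_def)
  moreover have "(\<Union>j. ?A j) = {\<omega> \<in> space M. n \<le> int (S \<omega>)}" by auto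
  ultimately have "((\<lambda>j. prob (?A j)) has_sum prob {\<omega> \<in> space M. n \<le> int (S \<omega>)}) UNIV"
    by (simp add: sums_nonneg_imp_has_sum)
  then have "(poisson_mass r has_sum prob {\<omega> \<in> space M. n \<le> int (S \<omega>)}) {j. n \<le> int j}"
    \<comment> \<open>The sets \<open>?A j\<close> are empty for \<open>j\<close> below \<open>n\<close> and are the level sets of \<open>S\<close> above.\<close>
    by (rule has_sum_cong_neutral[THEN iffD1, rotated -1]) (auto simp flip: mass)
  then show ?thesis
    by (simp add: poisson_tail_def infsumI)
qed

text \<open>
  Evaluation at time \<open>T\<close> is a measurable function of the path, so independence of the processes
  carries over to the counts at time \<open>T\<close>, which are increments because the paths start at 0.
\<close>

lemma total_count_tail:
  assumes T: "0 \<le> T"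
    and poisson: "\<And>i. i \<in> {1..k} \<Longrightarrow> poisson_process P F T (r i) (N i)"
    and indep: "independent_processes P k T N" and P: "prob_space P"
  shows "measure P {\<omega> \<in> space P. n \<le> int (\<Sum>i=1..k. N i T \<omega>)}
    = poisson_tail (\<Sum>i=1..k. LINT s:{0..T}|lborel. r i s) n"
proof -
  interpret prob_space P by (rule P)
  have "indep_vars (\<lambda>i. \<Pi>\<^sub>M t\<in>{0..T}. count_space UNIV)
      (\<lambda>i \<omega>. \<lambda>t\<in>{0..T}. N i t \<omega>) {1..k}"
    using indep by (simp add: independent_processes_def)
  then have "indep_vars (\<lambda>_. borel) (\<lambda>i \<omega>. real ((\<lambda>t\<in>{0..T}. N i t \<omega>) T)) {1..k}"
  proof (rule indep_vars_compose2[where Y = "\<lambda>i x. real (x T)"])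
    have "(\<lambda>x. x T) \<in> (\<Pi>\<^sub>M t\<in>{0..T}. count_space (UNIV :: nat set)) \<rightarrow>\<^sub>M count_space UNIV"
      using T by (intro measurable_component_singleton) simp
    then show "(\<lambda>x. real (x T)) \<in> (\<Pi>\<^sub>M t\<in>{0..T}. count_space (UNIV :: nat set)) \<rightarrow>\<^sub>M borel"
      by measurable
  qed
  then have "indep_vars (\<lambda>_. borel) (\<lambda>i \<omega>. real (N i T \<omega>)) {1..k}"
    using T by simp
  moreover have "prob {\<omega> \<in> space P. N i T \<omega> = j} = poisson_mass (LINT s:{0..T}|lborel. r i s) j"
    if "i \<in> {1..k}" for i j
  proof -
    have "N i 0 \<omega> = 0" if "\<omega> \<in> space P" for \<omega>
      using poisson[OF \<open>i \<in> {1..k}\<close>] that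
      by (simp add: poisson_process_def counting_process_def counting_path_def)
    then have "{\<omega> \<in> space P. N i T \<omega> = j} = {\<omega> \<in> space P. N i T \<omega> - N i 0 \<omega> = j}" by auto
    then show ?thesis
      using poisson[OF that] T by (simp add: poisson_process_def)
  qed
  ultimately have "prob {\<omega> \<in> space P. (\<Sum>i=1..k. N i T \<omega>) = j}
      = poisson_mass (\<Sum>i=1..k. LINT s:{0..T}|lborel. r i s) j" for j
    by (intro poisson_sum) auto
  moreover have "(\<lambda>\<omega>. \<Sum>i=1..k. N i T \<omega>) \<in> P \<rightarrow>\<^sub>M count_space UNIV"
  proof -
    have "N i T \<in> P \<rightarrow>\<^sub>M count_space UNIV" if "i \<in> {1..k}" for i
      using poisson[OF that] T by (simp add: poisson_process_def counting_process_def)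
    then show ?thesis by measurable
  qed
  ultimately show ?thesis by (intro poisson_tail_eq_prob)
qed

section \<open>The likelihood ratio\<close>

theorem mainTheorem2:
  fixes k :: nat and T :: real
    and \<beta> \<nu> :: "nat \<Rightarrow> real \<Rightarrow> real"
    and \<beta>min \<beta>max \<nu>min \<nu>max :: real
    and M P0 P1 :: "'a measure"
    and N :: "nat \<Rightarrow> real \<Rightarrow> 'a \<Rightarrow> nat"
    and L :: "'a \<Rightarrow> real" and B J C D \<gamma> :: real
  assumes k: "k \<ge> 1" and T: "T > 0"
    and \<beta>_bounds: "0 < \<beta>min" "\<beta>min < \<beta>max"
    and \<nu>_bounds: "0 < \<nu>min" "\<nu>min < \<nu>max"
    and \<beta>_cont: "\<And>i. i \<in> {1..k} \<Longrightarrow> continuous_on {0..T} (\<beta> i)"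
    and \<beta>_range: "\<And>i t. i \<in> {1..k} \<Longrightarrow> t \<in> {0..T} \<Longrightarrow> \<beta> i t \<in> {\<beta>min..\<beta>max}"
    and \<nu>_cont: "\<And>i. i \<in> {1..k} \<Longrightarrow> continuous_on {0..T} (\<nu> i)"
    and \<nu>_range: "\<And>i t. i \<in> {1..k} \<Longrightarrow> t \<in> {0..T} \<Longrightarrow> \<nu> i t \<in> {\<nu>min..\<nu>max}"
    and N: "\<And>i. i \<in> {1..k} \<Longrightarrow> counting_process M T (N i)"
    and P0: "prob_space P0" "sets P0 = sets M"
    and P1: "prob_space P1" "sets P1 = sets M"
    and P0_poisson: "\<And>i. i \<in> {1..k} \<Longrightarrow>
      poisson_process P0 (natural_filtration (space M) k N) T (\<beta> i) (N i)"
    and P0_indep: "independent_processes P0 k T N"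
    and P1_poisson: "\<And>i. i \<in> {1..k} \<Longrightarrow>
      poisson_process P1 (natural_filtration (space M) k N) T (\<lambda>t. \<beta> i t + \<nu> i t) (N i)"
    and P1_indep: "independent_processes P1 k T N"
    and L: "L = (\<lambda>\<omega>. \<Prod>i=1..k. exp (- (LINT s:{0..T}|lborel. \<nu> i s)) *
      (\<Prod>n=1..N i T \<omega>. 1 + \<nu> i (jump_time T (\<lambda>t. N i t \<omega>) n) / \<beta> i (jump_time T (\<lambda>t. N i t \<omega>) n)))"
    and B: "B = (\<Sum>i=1..k. LINT s:{0..T}|lborel. \<beta> i s)"
    and J: "J = (\<Sum>i=1..k. LINT s:{0..T}|lborel. \<nu> i s)"
    and C: "C = 1 + \<nu>min / \<beta>max"
    and D: "D = 1 + \<nu>max / \<beta>min"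
    and \<gamma>: "\<gamma> > 0"
  shows "measure P1 {\<omega> \<in> space M. L \<omega> \<ge> \<gamma>} \<ge> poisson_tail (J + B) \<lceil>(ln \<gamma> + J) / ln C\<rceil>
       \<and> measure P0 {\<omega> \<in> space M. L \<omega> \<ge> \<gamma>} \<le> poisson_tail B \<lceil>(ln \<gamma> + J) / ln D\<rceil>"
proof
  let ?g = "\<lambda>i t. 1 + \<nu> i t / \<beta> i t"
  let ?\<Pi> = "\<lambda>i \<omega>. \<Prod>n=1..N i T \<omega>. ?g i (jump_time T (\<lambda>t. N i t \<omega>) n)"
  let ?S = "\<lambda>\<omega>. \<Sum>i=1..k. N i T \<omega>"
  have space: "space P0 = space M" "space P1 = space M"
    using P0(2) P1(2) by (auto dest: sets_eq_imp_space_eq)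
  have C1: "1 < C" and D1: "1 < D"
    using C D \<beta>_bounds \<nu>_bounds by simp_all
  have g_range: "?g i t \<in> {C..D}" if "i \<in> {1..k}" "t \<in> {0..T}" for i t
    using \<beta>_range[OF that] \<nu>_range[OF that] \<beta>_bounds \<nu>_bounds
    by (auto simp: C D intro!: frac_le)
  have L_eq: "L \<omega> = exp (- J) * (\<Prod>i=1..k. ?\<Pi> i \<omega>)" for \<omega>
    unfolding L J by (simp only: prod.distrib exp_sum[OF finite_atLeastAtMost, symmetric] sum_negf)
  have L_bounds: "exp (- J) * C ^ ?S \<omega> \<le> L \<omega>" "L \<omega> \<le> exp (- J) * D ^ ?S \<omega>"
    if "\<omega> \<in> space M" for \<omega>
  proof -
    have *: "?\<Pi> i \<omega> \<in> {C ^ N i T \<omega>..D ^ N i T \<omega>}" if "i \<in> {1..k}" for i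
      using N[OF that] \<open>\<omega> \<in> space M\<close> T C1 g_range[OF that]
      by (intro jump_product_bounds) (auto simp: counting_process_def)
    have pos: "0 \<le> C ^ N i T \<omega>" for i using C1 by simp
    have nonneg: "0 \<le> ?\<Pi> i \<omega>" if "i \<in> {1..k}" for i
      using *[OF that] by (intro order_trans[OF pos[of i]]) simp
    have "C ^ ?S \<omega> \<le> (\<Prod>i=1..k. ?\<Pi> i \<omega>)"
      unfolding power_sum using * pos by (intro prod_mono) auto
    moreover have "(\<Prod>i=1..k. ?\<Pi> i \<omega>) \<le> D ^ ?S \<omega>"
      unfolding power_sum using * nonneg by (intro prod_mono) simp
    ultimately show "exp (- J) * C ^ ?S \<omega> \<le> L \<omega>" "L \<omega> \<le> exp (- J) * D ^ ?S \<omega>"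
      by (simp_all add: L_eq)
  qed
  have threshold: "\<gamma> \<le> exp (- J) * a ^ m \<longleftrightarrow> \<lceil>(ln \<gamma> + J) / ln a\<rceil> \<le> int m"
    if "1 < a" for a :: real and m
  proof -
    have "\<gamma> \<le> exp (- J) * a ^ m \<longleftrightarrow> ln \<gamma> \<le> ln (exp (- J) * a ^ m)"
      using that \<gamma> by (subst ln_le_cancel_iff) auto
    also have "\<dots> \<longleftrightarrow> ln \<gamma> + J \<le> real m * ln a"
      using that by (simp add: ln_mult ln_realpow algebra_simps)
    also have "\<dots> \<longleftrightarrow> (ln \<gamma> + J) / ln a \<le> real m"
      using that by (simp add: pos_divide_le_eq)
    also have "\<dots> \<longleftrightarrow> \<lceil>(ln \<gamma> + J) / ln a\<rceil> \<le> int m"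
      by (simp add: ceiling_le_iff)
    finally show ?thesis .
  qed
  have L_measurable: "L \<in> borel_measurable M"
  proof -
    have "?\<Pi> i \<in> borel_measurable M" if "i \<in> {1..k}" for i
    proof (rule jump_product_measurable)
      have "\<beta> i t \<noteq> 0" if "t \<in> {0..T}" for t
        using \<beta>_range[OF \<open>i \<in> {1..k}\<close> that] \<beta>_bounds(1) by auto
      then show "continuous_on {0..T} (?g i)"
        using \<beta>_cont[OF that] \<nu>_cont[OF that] by (intro continuous_intros) auto
    qed (use N[OF that] T in auto)
    then show ?thesis
      unfolding L_eq[abs_def] by (intro borel_measurable_times borel_measurable_prod) auto
  qed
  have "set_integrable lborel {0..T} (\<beta> i)" "set_integrable lborel {0..T} (\<nu> i)"
    if "i \<in> {1..k}" for i
    using \<beta>_cont[OF that] \<nu>_cont[OF that] by (auto intro: borel_integrable_atLeastAtMost')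
  then have JB: "J + B = (\<Sum>i=1..k. LINT s:{0..T}|lborel. \<beta> i s + \<nu> i s)"
    by (simp add: J B sum.distrib)

  show "measure P1 {\<omega> \<in> space M. L \<omega> \<ge> \<gamma>} \<ge> poisson_tail (J + B) \<lceil>(ln \<gamma> + J) / ln C\<rceil>"
  proof -
    interpret prob_space P1 by (rule P1)
    \<comment> \<open>Needed for a lower bound: \<^const>\<open>measure\<close> is 0 on sets that are not measurable.\<close>
    have "{\<omega> \<in> space M. L \<omega> \<ge> \<gamma>} \<in> sets M"
      using L_measurable by measurable
    moreover have "{\<omega> \<in> space M. \<lceil>(ln \<gamma> + J) / ln C\<rceil> \<le> int (?S \<omega>)} \<subseteq> {\<omega> \<in> space M. L \<omega> \<ge> \<gamma>}"
    proof safe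
      fix \<omega> assume "\<omega> \<in> space M" "\<lceil>(ln \<gamma> + J) / ln C\<rceil> \<le> int (?S \<omega>)"
      then show "\<gamma> \<le> L \<omega>"
        using threshold[OF C1, of "?S \<omega>"] L_bounds(1)[of \<omega>] by linarith
    qed
    ultimately have "prob {\<omega> \<in> space M. \<lceil>(ln \<gamma> + J) / ln C\<rceil> \<le> int (?S \<omega>)}
        \<le> prob {\<omega> \<in> space M. L \<omega> \<ge> \<gamma>}"
      by (intro finite_measure_mono) (simp_all add: P1)
    then show ?thesis
      using total_count_tail[OF _ P1_poisson P1_indep P1(1), of "\<lceil>(ln \<gamma> + J) / ln C\<rceil>"] T
      by (simp add: JB space)
  qed

  show "measure P0 {\<omega> \<in> space M. L \<omega> \<ge> \<gamma>} \<le> poisson_tail B \<lceil>(ln \<gamma> + J) / ln D\<rceil>"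
  proof -
    interpret prob_space P0 by (rule P0)
    have "N i T \<in> M \<rightarrow>\<^sub>M count_space UNIV" if "i \<in> {1..k}" for i
      using N[OF that] T by (simp add: counting_process_def)
    then have "?S \<in> M \<rightarrow>\<^sub>M count_space UNIV" by measurable
    then have "?S -` {m. \<lceil>(ln \<gamma> + J) / ln D\<rceil> \<le> int m} \<inter> space M \<in> sets M"
      by (rule measurable_sets) simp
    then have "{\<omega> \<in> space M. \<lceil>(ln \<gamma> + J) / ln D\<rceil> \<le> int (?S \<omega>)} \<in> sets M"
      by (simp only: vimage_def mem_Collect_eq Int_def conj_commute)
    moreover have "{\<omega> \<in> space M. L \<omega> \<ge> \<gamma>} \<subseteq> {\<omega> \<in> space M. \<lceil>(ln \<gamma> + J) / ln D\<rceil> \<le> int (?S \<omega>)}"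
    proof safe
      fix \<omega> assume "\<omega> \<in> space M" "\<gamma> \<le> L \<omega>"
      then have "\<gamma> \<le> exp (- J) * D ^ ?S \<omega>"
        using L_bounds(2)[of \<omega>] by linarith
      then show "\<lceil>(ln \<gamma> + J) / ln D\<rceil> \<le> int (?S \<omega>)"
        using threshold[OF D1] by blast
    qed
    ultimately have "prob {\<omega> \<in> space M. L \<omega> \<ge> \<gamma>}
        \<le> prob {\<omega> \<in> space M. \<lceil>(ln \<gamma> + J) / ln D\<rceil> \<le> int (?S \<omega>)}"
      by (intro finite_measure_mono) (simp_all add: P0)
    then show ?thesis
      using total_count_tail[OF _ P0_poisson P0_indep P0(1), of "\<lceil>(ln \<gamma> + J) / ln D\<rceil>"] T
      by (simp add: B space)
  qed
qed

end
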